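(* The category $\mathbf{AdMon}$ of adjunctions in monoids is equivalent to the category (Birkhoff variety of algebras) whose objects are monoids $M$ equipped with a structure $(M,\ f\colon M\to M,\ \eta,\varepsilon\in M)$, where $f$ is a monoid endomorphism, satisfying $$\varepsilon\eta=1,\qquad \varepsilon f(\eta)=1,\qquad \varepsilon f(\varepsilon)=\varepsilon^2,$$ $$\varepsilon f^2(m)=f(m)\varepsilon\quad(m\in M),\qquad f(m)\eta=\eta m\quad(m\in M),$$ and whose morphisms $(M,f,\eta,\varepsilon)\to(M',f',\eta',\varepsilon')$ are the monoid homomorphisms $h\colon M\to M'$ with $h\circ f=f'\circ h$, $h(\eta)=\eta'$, $h(\varepsilon)=\varepsilon'$.
   Context: A monoid is regarded as a one-object category (composition is multiplication) and monoid homomorphisms as functors. An adjunction in monoids $(f,g,\eta,\varepsilon)\colon M\rightharpoonup N$ consists of monoids $M,N$, monoid homomorphisms $f\colon M\to N$, $g\colon N\to M$, and elements $\eta\in M$ (unit), $\varepsilon\in N$ (counit) such that $g(f(m))\,\eta=\eta m$ for all $m\in M$, $\varepsilon\, f(g(n))=n\varepsilon$ for all $n\in N$, $g(\varepsilon)\eta=1_M$, and $\varepsilon f(\eta)=1_N$. The category $\mathbf{AdMon}$ has as objects all adjunctions in monoids; a morphism from $(f,g,\eta,\varepsilon)\colon M\rightharpoonup N$ to $(f',g',\eta',\varepsilon')\colon M'\rightharpoonup N'$ is a pair of monoid homomorphisms $(l\colon M\to M',\ r\colon N\to N')$ with $r\circ f=f'\circ l$, $l\circ g=g'\circ r$, $r(\varepsilon)=\varepsilon'$,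 $l(\eta)=\eta'$; composition is componentwise. $f^2=f\circ f$. *)

theory Defs
  imports "HOL-Algebra.Group"
begin

section \<open>Categories and equivalences of categories\<close>

text \<open>
  Hom-sets of different pairs of objects need not be disjoint, so composition and the arrow part
  of a functor take the objects involved as arguments. \<open>comp_arr C X Y Z g f\<close> is the composite
  of \<open>f\<close> from \<open>X\<close> to \<open>Y\<close> with \<open>g\<close> from \<open>Y\<close> to \<open>Z\<close>.
\<close>

record ('o, 'm) category =
  ob :: "'o set"
  hom_set :: "'o \<Rightarrow> 'o \<Rightarrow> 'm set"
  id_arr :: "'o \<Rightarrow> 'm"
  comp_arr :: "'o \<Rightarrow> 'o \<Rightarrow> 'o \<Rightarrow> 'm \<Rightarrow> 'm \<Rightarrow> 'm"

definition is_category :: "('o, 'm) category \<Rightarrow> bool" where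
  "is_category C \<longleftrightarrow>
     (\<forall>X \<in> ob C. id_arr C X \<in> hom_set C X X) \<and>
     (\<forall>X \<in> ob C. \<forall>Y \<in> ob C. \<forall>Z \<in> ob C. \<forall>f \<in> hom_set C X Y. \<forall>g \<in> hom_set C Y Z.
        comp_arr C X Y Z g f \<in> hom_set C X Z) \<and>
     (\<forall>X \<in> ob C. \<forall>Y \<in> ob C. \<forall>f \<in> hom_set C X Y.
        comp_arr C X X Y f (id_arr C X) = f \<and> comp_arr C X Y Y (id_arr C Y) f = f) \<and>
     (\<forall>W \<in> ob C. \<forall>X \<in> ob C. \<forall>Y \<in> ob C. \<forall>Z \<in> ob C.
        \<forall>f \<in> hom_set C W X. \<forall>g \<in> hom_set C X Y. \<forall>h \<in> hom_set C Y Z.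
        comp_arr C W X Z (comp_arr C X Y Z h g) f = comp_arr C W Y Z h (comp_arr C W X Y g f))"

record ('o, 'm, 'p, 'n) func =
  on_ob :: "'o \<Rightarrow> 'p"
  on_arr :: "'o \<Rightarrow> 'o \<Rightarrow> 'm \<Rightarrow> 'n"

definition is_functor ::
  "('o, 'm) category \<Rightarrow> ('p, 'n) category \<Rightarrow> ('o, 'm, 'p, 'n) func \<Rightarrow> bool" where
  "is_functor C D F \<longleftrightarrow>
     (\<forall>X \<in> ob C. on_ob F X \<in> ob D) \<and>
     (\<forall>X \<in> ob C. \<forall>Y \<in> ob C. \<forall>f \<in> hom_set C X Y.
        on_arr F X Y f \<in> hom_set D (on_ob F X) (on_ob F Y)) \<and>
     (\<forall>X \<in> ob C. on_arr F X X (id_arr C X) = id_arr D (on_ob F X)) \<and>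
     (\<forall>X \<in> ob C. \<forall>Y \<in> ob C. \<forall>Z \<in> ob C. \<forall>f \<in> hom_set C X Y. \<forall>g \<in> hom_set C Y Z.
        on_arr F X Z (comp_arr C X Y Z g f) =
        comp_arr D (on_ob F X) (on_ob F Y) (on_ob F Z) (on_arr F Y Z g) (on_arr F X Y f))"

definition id_func :: "('o, 'm, 'o, 'm) func" where
  "id_func = \<lparr>on_ob = (\<lambda>X. X), on_arr = (\<lambda>X Y f. f)\<rparr>"

definition comp_func ::
  "('p, 'n, 'q, 'k) func \<Rightarrow> ('o, 'm, 'p, 'n) func \<Rightarrow> ('o, 'm, 'q, 'k) func" where
  "comp_func G F =
     \<lparr>on_ob = (\<lambda>X. on_ob G (on_ob F X)),
      on_arr = (\<lambda>X Y f. on_arr G (on_ob F X) (on_ob F Y) (on_arr F X Y f))\<rparr>"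

definition is_iso :: "('o, 'm) category \<Rightarrow> 'o \<Rightarrow> 'o \<Rightarrow> 'm \<Rightarrow> bool" where
  "is_iso C X Y f \<longleftrightarrow> f \<in> hom_set C X Y \<and>
     (\<exists>g \<in> hom_set C Y X.
        comp_arr C X Y X g f = id_arr C X \<and> comp_arr C Y X Y f g = id_arr C Y)"

definition naturally_isomorphic ::
  "('o, 'm) category \<Rightarrow> ('p, 'n) category \<Rightarrow>
   ('o, 'm, 'p, 'n) func \<Rightarrow> ('o, 'm, 'p, 'n) func \<Rightarrow> bool" where
  "naturally_isomorphic C D F G \<longleftrightarrow>
     (\<exists>\<tau>. (\<forall>X \<in> ob C. is_iso D (on_ob F X) (on_ob G X) (\<tau> X)) \<and>
          (\<forall>X \<in> ob C. \<forall>Y \<in> ob C. \<forall>f \<in> hom_set C X Y.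
             comp_arr D (on_ob F X) (on_ob F Y) (on_ob G Y) (\<tau> Y) (on_arr F X Y f) =
             comp_arr D (on_ob F X) (on_ob G X) (on_ob G Y) (on_arr G X Y f) (\<tau> X)))"

definition equivalent_categories :: "('o, 'm) category \<Rightarrow> ('p, 'n) category \<Rightarrow> bool" where
  "equivalent_categories C D \<longleftrightarrow> is_category C \<and> is_category D \<and>
     (\<exists>F G. is_functor C D F \<and> is_functor D C G \<and>
        naturally_isomorphic C C (comp_func G F) id_func \<and>
        naturally_isomorphic D D (comp_func F G) id_func)"


section \<open>Adjunctions in monoids\<close>

text \<open>\<open>hom\<close> alone does not require that the neutral element is preserved.\<close>

definition monoid_homs :: "('a, 'c) monoid_scheme \<Rightarrow> ('b, 'd) monoid_scheme \<Rightarrow> ('a \<Rightarrow> 'b) set" where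
  "monoid_homs M N = {h \<in> hom M N. h \<one>\<^bsub>M\<^esub> = \<one>\<^bsub>N\<^esub>}"

text \<open>
  A type \<open>'a\<close> plays the role of the universe in which the carriers of all monoids live.
  Operations of an object (the multiplication, the homomorphisms \<open>f\<close>, \<open>g\<close>) are unconstrained
  outside the carriers; objects that differ only there are isomorphic. Morphisms, in contrast, are
  taken extensional, so that they are equal as soon as they agree on the carriers.
\<close>

record 'a adjunction =
  adj_dom :: "'a monoid"
  adj_cod :: "'a monoid"
  adj_left :: "'a \<Rightarrow> 'a"
  adj_right :: "'a \<Rightarrow> 'a"
  adj_unit :: 'a
  adj_counit :: 'a

definition is_adjunction :: "'a adjunction \<Rightarrow> bool" where
  "is_adjunction A \<longleftrightarrow>
     (let M = adj_dom A; N = adj_cod A; f = adj_left A; g = adj_right A;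
          \<eta> = adj_unit A; \<epsilon> = adj_counit A
      in monoid M \<and> monoid N \<and> f \<in> monoid_homs M N \<and> g \<in> monoid_homs N M \<and>
         \<eta> \<in> carrier M \<and> \<epsilon> \<in> carrier N \<and>
         (\<forall>m \<in> carrier M. g (f m) \<otimes>\<^bsub>M\<^esub> \<eta> = \<eta> \<otimes>\<^bsub>M\<^esub> m) \<and>
         (\<forall>n \<in> carrier N. \<epsilon> \<otimes>\<^bsub>N\<^esub> f (g n) = n \<otimes>\<^bsub>N\<^esub> \<epsilon>) \<and>
         g \<epsilon> \<otimes>\<^bsub>M\<^esub> \<eta> = \<one>\<^bsub>M\<^esub> \<and>
         \<epsilon> \<otimes>\<^bsub>N\<^esub> f \<eta> = \<one>\<^bsub>N\<^esub>)"

definition adjunction_homs :: "'a adjunction \<Rightarrow> 'a adjunction \<Rightarrow> (('a \<Rightarrow> 'a) \<times> ('a \<Rightarrow> 'a)) set" where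
  "adjunction_homs A B =
     {(l, r). l \<in> monoid_homs (adj_dom A) (adj_dom B) \<and> l \<in> extensional (carrier (adj_dom A)) \<and>
              r \<in> monoid_homs (adj_cod A) (adj_cod B) \<and> r \<in> extensional (carrier (adj_cod A)) \<and>
              (\<forall>m \<in> carrier (adj_dom A). r (adj_left A m) = adj_left B (l m)) \<and>
              (\<forall>n \<in> carrier (adj_cod A). l (adj_right A n) = adj_right B (r n)) \<and>
              r (adj_counit A) = adj_counit B \<and>
              l (adj_unit A) = adj_unit B}"

definition AdMon :: "('a adjunction, ('a \<Rightarrow> 'a) \<times> ('a \<Rightarrow> 'a)) category" where
  "AdMon =
     \<lparr>ob = {A. is_adjunction A},
      hom_set = adjunction_homs,
      id_arr = (\<lambda>A. (\<lambda>m \<in> carrier (adj_dom A). m, \<lambda>n \<in> carrier (adj_cod A). n)),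
      comp_arr = (\<lambda>A B C (l', r') (l, r).
        (compose (carrier (adj_dom A)) l' l, compose (carrier (adj_cod A)) r' r))\<rparr>"


section \<open>Monoids with an endomorphism and two constants\<close>

record 'a adj_monoid = "'a monoid" +
  endo :: "'a \<Rightarrow> 'a"
  eta :: 'a
  eps :: 'a

definition is_adj_monoid :: "'a adj_monoid \<Rightarrow> bool" where
  "is_adj_monoid M \<longleftrightarrow>
     (let f = endo M; \<eta> = eta M; \<epsilon> = eps M
      in monoid M \<and> f \<in> monoid_homs M M \<and> \<eta> \<in> carrier M \<and> \<epsilon> \<in> carrier M \<and>
         \<epsilon> \<otimes>\<^bsub>M\<^esub> \<eta> = \<one>\<^bsub>M\<^esub> \<and>
         \<epsilon> \<otimes>\<^bsub>M\<^esub> f \<eta> = \<one>\<^bsub>M\<^esub> \<and>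
         \<epsilon> \<otimes>\<^bsub>M\<^esub> f \<epsilon> = \<epsilon> \<otimes>\<^bsub>M\<^esub> \<epsilon> \<and>
         (\<forall>m \<in> carrier M. \<epsilon> \<otimes>\<^bsub>M\<^esub> f (f m) = f m \<otimes>\<^bsub>M\<^esub> \<epsilon>) \<and>
         (\<forall>m \<in> carrier M. f m \<otimes>\<^bsub>M\<^esub> \<eta> = \<eta> \<otimes>\<^bsub>M\<^esub> m))"

definition adj_monoid_homs :: "'a adj_monoid \<Rightarrow> 'a adj_monoid \<Rightarrow> ('a \<Rightarrow> 'a) set" where
  "adj_monoid_homs M N =
     {h. h \<in> monoid_homs M N \<and> h \<in> extensional (carrier M) \<and>
         (\<forall>m \<in> carrier M. h (endo M m) = endo N (h m)) \<and>
         h (eta M) = eta N \<and>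
         h (eps M) = eps N}"

definition AdjMonoids :: "('a adj_monoid, 'a \<Rightarrow> 'a) category" where
  "AdjMonoids =
     \<lparr>ob = {M. is_adj_monoid M},
      hom_set = adj_monoid_homs,
      id_arr = (\<lambda>M. \<lambda>m \<in> carrier M. m),
      comp_arr = (\<lambda>M N K h' h. compose (carrier M) h' h)\<rparr>"


section \<open>Birkhoff varieties\<close>

datatype 's trm = Var nat | App 's "'s trm list"

fun wf_trm :: "('s \<Rightarrow> nat) \<Rightarrow> 's trm \<Rightarrow> bool" where
  "wf_trm ar (Var i) \<longleftrightarrow> True"
| "wf_trm ar (App s ts) \<longleftrightarrow> length ts = ar s \<and> (\<forall>t \<in> set ts. wf_trm ar t)"

fun trm_val :: "('s \<Rightarrow> 'a list \<Rightarrow> 'a) \<Rightarrow> (nat \<Rightarrow> 'a) \<Rightarrow> 's trm \<Rightarrow> 'a" where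
  "trm_val I v (Var i) = v i"
| "trm_val I v (App s ts) = I s (map (trm_val I v) ts)"

definition sig_algebra :: "('s \<Rightarrow> nat) \<Rightarrow> 'a set \<Rightarrow> ('s \<Rightarrow> 'a list \<Rightarrow> 'a) \<Rightarrow> bool" where
  "sig_algebra ar A I \<longleftrightarrow> (\<forall>s xs. length xs = ar s \<and> set xs \<subseteq> A \<longrightarrow> I s xs \<in> A)"

definition sig_homs ::
  "('s \<Rightarrow> nat) \<Rightarrow> 'a set \<Rightarrow> ('s \<Rightarrow> 'a list \<Rightarrow> 'a) \<Rightarrow> 'b set \<Rightarrow> ('s \<Rightarrow> 'b list \<Rightarrow> 'b) \<Rightarrow> ('a \<Rightarrow> 'b) set" where
  "sig_homs ar A I B J =
     {h \<in> A \<rightarrow>\<^sub>E B. \<forall>s xs. length xs = ar s \<and> set xs \<subseteq> A \<longrightarrow> h (I s xs) = J s (map h xs)}"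

definition satisfies :: "'a set \<Rightarrow> ('s \<Rightarrow> 'a list \<Rightarrow> 'a) \<Rightarrow> 's trm \<times> 's trm \<Rightarrow> bool" where
  "satisfies A I e \<longleftrightarrow>
     (\<forall>v. (\<forall>i. v i \<in> A) \<longrightarrow> trm_val I v (fst e) = trm_val I v (snd e))"

text \<open>
  \<open>C\<close> is the category of all algebras for the signature \<open>ar\<close> that satisfy the identities \<open>E\<close>,
  with all homomorphisms between them, where an object \<open>X\<close> of \<open>C\<close> is read as the algebra with
  underlying set \<open>U X\<close> and operations \<open>I X\<close>.
\<close>

definition is_variety ::
  "('s \<Rightarrow> nat) \<Rightarrow> ('s trm \<times> 's trm) set \<Rightarrow> ('o \<Rightarrow> 'a set) \<Rightarrow> ('o \<Rightarrow> 's \<Rightarrow> 'a list \<Rightarrow> 'a) \<Rightarrow>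
   ('o, 'a \<Rightarrow> 'a) category \<Rightarrow> bool" where
  "is_variety ar E U I C \<longleftrightarrow>
     (\<forall>(s, t) \<in> E. wf_trm ar s \<and> wf_trm ar t) \<and>
     (\<forall>X. X \<in> ob C \<longleftrightarrow> sig_algebra ar (U X) (I X) \<and> (\<forall>e \<in> E. satisfies (U X) (I X) e)) \<and>
     (\<forall>X \<in> ob C. \<forall>Y \<in> ob C. hom_set C X Y = sig_homs ar (U X) (I X) (U Y) (I Y)) \<and>
     (\<forall>X \<in> ob C. id_arr C X = (\<lambda>x \<in> U X. x)) \<and>
     (\<forall>X \<in> ob C. \<forall>Y \<in> ob C. \<forall>Z \<in> ob C. \<forall>f \<in> hom_set C X Y. \<forall>g \<in> hom_set C Y Z.
        comp_arr C X Y Z g f = compose (U X) g f)"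

datatype adj_op = Op_mult | Op_one | Op_endo | Op_eta | Op_eps

fun adj_arity :: "adj_op \<Rightarrow> nat" where
  "adj_arity Op_mult = 2"
| "adj_arity Op_one = 0"
| "adj_arity Op_endo = 1"
| "adj_arity Op_eta = 0"
| "adj_arity Op_eps = 0"

text \<open>The values on argument lists of the wrong length are irrelevant.\<close>

definition adj_interp :: "'a adj_monoid \<Rightarrow> adj_op \<Rightarrow> 'a list \<Rightarrow> 'a" where
  "adj_interp M s xs =
     (case s of
        Op_mult \<Rightarrow> (xs ! 0) \<otimes>\<^bsub>M\<^esub> (xs ! 1)
      | Op_one \<Rightarrow> \<one>\<^bsub>M\<^esub>
      | Op_endo \<Rightarrow> endo M (xs ! 0)
      | Op_eta \<Rightarrow> eta M
      | Op_eps \<Rightarrow> eps M)"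

definition adj_identities :: "(adj_op trm \<times> adj_op trm) set" where
  "adj_identities =
     (let x = Var 0; y = Var 1; z = Var 2;
          mul = (\<lambda>s t. App Op_mult [s, t]); one = App Op_one []; f = (\<lambda>t. App Op_endo [t]);
          \<eta> = App Op_eta []; \<epsilon> = App Op_eps []
      in {(mul (mul x y) z, mul x (mul y z)),
          (mul one x, x),
          (mul x one, x),
          (f (mul x y), mul (f x) (f y)),
          (f one, one),
          (mul \<epsilon> \<eta>, one),
          (mul \<epsilon> (f \<eta>), one),
          (mul \<epsilon> (f \<epsilon>), mul \<epsilon> \<epsilon>),
          (mul \<epsilon> (f (f x)), mul (f x) \<epsilon>),
          (mul (f x) \<eta>, mul \<eta> x)})"

end

theory Submission
  imports Defs
begin

text \<open>
  The algebras \<open>(M, f, \<eta>, \<epsilon>)\<close> are the monads on one-object categories: \<open>f\<close> is the endofunctor,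
  \<open>\<eta>\<close> the unit and \<open>\<epsilon>\<close> the multiplication, \<open>f(m) \<eta> = \<eta> m\<close> and \<open>\<epsilon> f\<^sup>2(m) = f(m) \<epsilon>\<close> are naturality,
  and \<open>\<epsilon> \<eta> = 1\<close>, \<open>\<epsilon> f(\<eta>) = 1\<close>, \<open>\<epsilon> f(\<epsilon>) = \<epsilon>\<^sup>2\<close> are the unit and associativity laws. An adjunction
  \<open>(f, g, \<eta>, \<epsilon>)\<close> induces the monad \<open>(g f, \<eta>, g(\<epsilon>))\<close> on its domain. Since a homomorphism of monoids,
  seen as a functor, is bijective on objects, every adjunction in monoids is the Kleisli adjunction of
  its monad, up to isomorphism; hence passing to the induced monad is an equivalence.

  The inverse functor needs a model of the Kleisli category inside the universe of carriers. Its
  elements are those of \<open>M\<close>, with the product of \<open>m\<close> and \<open>k\<close> being \<open>\<epsilon> f(m) k\<close>, and its right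
  adjoint \<open>m \<mapsto> \<epsilon> f(m)\<close> is an injective homomorphism to \<open>M\<close> (a retraction is \<open>x \<mapsto> x \<eta>\<close>, because
  \<open>\<epsilon> f(m) \<eta> = \<epsilon> \<eta> m = m\<close>). It can therefore be replaced by its image: the set of all \<open>\<epsilon> f(m)\<close> is a
  submonoid \<open>N\<close> of \<open>M\<close> that contains \<open>\<epsilon>\<close> and the image of \<open>f\<close>, and \<open>f: M \<rightarrow> N\<close> is left adjoint to
  the inclusion (\<open>is_adjunction_kleisli_adjunction\<close>).

  With this choice the monad of the Kleisli adjunction of an algebra is that algebra itself. In the
  other direction, the right adjoint \<open>g\<close> of any adjunction is injective, since \<open>n = \<epsilon> f(g(n) \<eta>)\<close>
  (\<open>counit_left_right_unit\<close>), and its image is exactly the submonoid above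
  (\<open>kleisli_arrows_induced_monad\<close>). So the adjunction is isomorphic to the Kleisli adjunction of its
  monad, by the identity on the domain and \<open>g\<close> on the codomain. That the algebras form a variety
  is a matter of reading each axiom as an identity.
\<close>

section \<open>Monoid homomorphisms\<close>

lemma monoid_homs_closed: "h \<in> monoid_homs M N \<Longrightarrow> x \<in> carrier M \<Longrightarrow> h x \<in> carrier N"
  by (auto simp: monoid_homs_def hom_def)

lemma monoid_homs_mult:
  "h \<in> monoid_homs M N \<Longrightarrow> x \<in> carrier M \<Longrightarrow> y \<in> carrier M \<Longrightarrow>
    h (x \<otimes>\<^bsub>M\<^esub> y) = h x \<otimes>\<^bsub>N\<^esub> h y"
  by (simp add: monoid_homs_def hom_def)

lemma monoid_homs_one: "h \<in> monoid_homs M N \<Longrightarrow> h \<one>\<^bsub>M\<^esub> = \<one>\<^bsub>N\<^esub>"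
  by (simp add: monoid_homs_def)

lemma monoid_homs_funcset: "h \<in> monoid_homs M N \<Longrightarrow> h \<in> carrier M \<rightarrow> carrier N"
  by (rule funcsetI) (rule monoid_homs_closed)

lemma monoid_homsI:
  assumes "\<And>x. x \<in> carrier M \<Longrightarrow> h x \<in> carrier N"
    and "\<And>x y. x \<in> carrier M \<Longrightarrow> y \<in> carrier M \<Longrightarrow> h (x \<otimes>\<^bsub>M\<^esub> y) = h x \<otimes>\<^bsub>N\<^esub> h y"
    and "h \<one>\<^bsub>M\<^esub> = \<one>\<^bsub>N\<^esub>"
  shows "h \<in> monoid_homs M N"
  using assms by (auto simp: monoid_homs_def hom_def)

lemma restrict_id_monoid_homs: "monoid M \<Longrightarrow> (\<lambda>x \<in> carrier M. x) \<in> monoid_homs M M"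
  by (rule monoid_homsI) (simp_all add: monoid.m_closed monoid.one_closed)

lemma compose_monoid_homs:
  assumes "monoid L" "f \<in> monoid_homs L M" "g \<in> monoid_homs M N"
  shows "compose (carrier L) g f \<in> monoid_homs L N"
  by (rule monoid_homsI)
    (simp_all add: compose_eq monoid.m_closed monoid.one_closed assms(1)
      monoid_homs_closed[OF assms(2)] monoid_homs_closed[OF assms(3)] monoid_homs_mult[OF assms(2)]
      monoid_homs_mult[OF assms(3)] monoid_homs_one[OF assms(2)] monoid_homs_one[OF assms(3)])

lemma compose_restrict_id: "h \<in> extensional A \<Longrightarrow> compose A h (\<lambda>x \<in> A. x) = h"
  by (rule extensionalityI[of _ A]) (simp_all add: compose_extensional compose_eq)

lemma restrict_id_compose:
  "h \<in> monoid_homs M N \<Longrightarrow> h \<in> extensional (carrier M) \<Longrightarrow>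
    compose (carrier M) (\<lambda>y \<in> carrier N. y) h = h"
  by (rule Id_compose[OF monoid_homs_funcset])

lemma compose_compose:
  "f \<in> monoid_homs L M \<Longrightarrow>
    compose (carrier L) (compose (carrier M) h g) f = compose (carrier L) h (compose (carrier L) g f)"
  by (rule compose_assoc[OF monoid_homs_funcset, symmetric])

section \<open>The two categories\<close>

locale monoid_adjunction =
  fixes A :: "'a adjunction"
  assumes adjunction: "is_adjunction A"
begin

lemma monoid_dom: "monoid (adj_dom A)"
  and monoid_cod: "monoid (adj_cod A)"
  and left_hom: "adj_left A \<in> monoid_homs (adj_dom A) (adj_cod A)"
  and right_hom: "adj_right A \<in> monoid_homs (adj_cod A) (adj_dom A)"
  and unit_closed: "adj_unit A \<in> carrier (adj_dom A)"
  and counit_closed: "adj_counit A \<in> carrier (adj_cod A)"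
  and unit_natural: "m \<in> carrier (adj_dom A) \<Longrightarrow>
    adj_right A (adj_left A m) \<otimes>\<^bsub>adj_dom A\<^esub> adj_unit A = adj_unit A \<otimes>\<^bsub>adj_dom A\<^esub> m"
  and counit_natural: "n \<in> carrier (adj_cod A) \<Longrightarrow>
    adj_counit A \<otimes>\<^bsub>adj_cod A\<^esub> adj_left A (adj_right A n) = n \<otimes>\<^bsub>adj_cod A\<^esub> adj_counit A"
  and triangle_right:
    "adj_right A (adj_counit A) \<otimes>\<^bsub>adj_dom A\<^esub> adj_unit A = \<one>\<^bsub>adj_dom A\<^esub>"
  and triangle_left:
    "adj_counit A \<otimes>\<^bsub>adj_cod A\<^esub> adj_left A (adj_unit A) = \<one>\<^bsub>adj_cod A\<^esub>"
  using adjunction by (simp_all add: is_adjunction_def Let_def)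

sublocale M: monoid "adj_dom A" by (rule monoid_dom)
sublocale N: monoid "adj_cod A" by (rule monoid_cod)

lemmas left_closed = monoid_homs_closed[OF left_hom]
lemmas left_mult = monoid_homs_mult[OF left_hom]
lemmas left_one = monoid_homs_one[OF left_hom]
lemmas right_closed = monoid_homs_closed[OF right_hom]
lemmas right_mult = monoid_homs_mult[OF right_hom]
lemmas right_one = monoid_homs_one[OF right_hom]

lemmas closed_simps = unit_closed counit_closed left_closed right_closed

end

text \<open>Here \<open>endo M\<close>, \<open>eta M\<close>, \<open>eps M\<close> are the functor, the unit and the multiplication of a monad.\<close>

locale monoid_monad =
  fixes M :: "'a adj_monoid" (structure)
  assumes adj_monoid: "is_adj_monoid M"
begin

lemma monoid_carrier: "monoid M"
  and endo_hom: "endo M \<in> monoid_homs M M"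
  and eta_closed: "eta M \<in> carrier M"
  and eps_closed: "eps M \<in> carrier M"
  and eps_eta: "eps M \<otimes> eta M = \<one>"
  and eps_endo_eta: "eps M \<otimes> endo M (eta M) = \<one>"
  and eps_assoc: "eps M \<otimes> endo M (eps M) = eps M \<otimes> eps M"
  and eps_natural: "m \<in> carrier M \<Longrightarrow> eps M \<otimes> endo M (endo M m) = endo M m \<otimes> eps M"
  and eta_natural: "m \<in> carrier M \<Longrightarrow> endo M m \<otimes> eta M = eta M \<otimes> m"
  using adj_monoid by (simp_all add: is_adj_monoid_def Let_def)

sublocale monoid M by (rule monoid_carrier)

lemmas endo_closed = monoid_homs_closed[OF endo_hom]
lemmas endo_mult = monoid_homs_mult[OF endo_hom]
lemmas endo_one = monoid_homs_one[OF endo_hom]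

lemmas closed_simps = eta_closed eps_closed endo_closed

end

lemma is_category_AdMon: "is_category AdMon"
  unfolding is_category_def
proof (intro conjI ballI)
  fix A :: "'a adjunction"
  assume "A \<in> ob AdMon"
  then interpret monoid_adjunction A by unfold_locales (simp add: AdMon_def)
  show "id_arr AdMon A \<in> hom_set AdMon A A"
    by (simp add: AdMon_def adjunction_homs_def restrict_id_monoid_homs monoid_dom monoid_cod
        closed_simps)
next
  fix A B C :: "'a adjunction" and f g
  assume "A \<in> ob AdMon" and fg: "f \<in> hom_set AdMon A B" "g \<in> hom_set AdMon B C"
  then interpret monoid_adjunction A by unfold_locales (simp add: AdMon_def)
  obtain l r l' r' where eqs: "f = (l, r)" "g = (l', r')"
    by (cases f, cases g) blast
  with fg have "(l, r) \<in> adjunction_homs A B" "(l', r') \<in> adjunction_homs B C"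
    by (simp_all add: AdMon_def)
  then have homs: "l \<in> monoid_homs (adj_dom A) (adj_dom B)" "r \<in> monoid_homs (adj_cod A) (adj_cod B)"
      "l' \<in> monoid_homs (adj_dom B) (adj_dom C)" "r' \<in> monoid_homs (adj_cod B) (adj_cod C)"
    and eqs': "\<forall>m \<in> carrier (adj_dom A). r (adj_left A m) = adj_left B (l m)"
      "\<forall>n \<in> carrier (adj_cod A). l (adj_right A n) = adj_right B (r n)"
      "r (adj_counit A) = adj_counit B" "l (adj_unit A) = adj_unit B"
      "\<forall>m \<in> carrier (adj_dom B). r' (adj_left B m) = adj_left C (l' m)"
      "\<forall>n \<in> carrier (adj_cod B). l' (adj_right B n) = adj_right C (r' n)"
      "r' (adj_counit B) = adj_counit C" "l' (adj_unit B) = adj_unit C"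
    by (simp_all add: adjunction_homs_def)
  show "comp_arr AdMon A B C g f \<in> hom_set AdMon A C"
    by (simp add: AdMon_def adjunction_homs_def eqs eqs' compose_eq closed_simps
        compose_monoid_homs[OF monoid_dom homs(1,3)] compose_monoid_homs[OF monoid_cod homs(2,4)]
        monoid_homs_closed[OF homs(1)] monoid_homs_closed[OF homs(2)])
qed (auto simp: AdMon_def adjunction_homs_def compose_restrict_id restrict_id_compose
    compose_compose)

lemma is_category_AdjMonoids: "is_category AdjMonoids"
  unfolding is_category_def
proof (intro conjI ballI)
  fix M :: "'a adj_monoid"
  assume "M \<in> ob AdjMonoids"
  then interpret monoid_monad M by unfold_locales (simp add: AdjMonoids_def)
  show "id_arr AdjMonoids M \<in> hom_set AdjMonoids M M"
    by (simp add: AdjMonoids_def adj_monoid_homs_def restrict_id_monoid_homs monoid_carrier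
        closed_simps)
next
  fix M N K :: "'a adj_monoid" and f g
  assume "M \<in> ob AdjMonoids" and fg: "f \<in> hom_set AdjMonoids M N" "g \<in> hom_set AdjMonoids N K"
  then interpret monoid_monad M by unfold_locales (simp add: AdjMonoids_def)
  have homs: "f \<in> monoid_homs M N" "g \<in> monoid_homs N K"
    using fg by (simp_all add: AdjMonoids_def adj_monoid_homs_def)
  show "comp_arr AdjMonoids M N K g f \<in> hom_set AdjMonoids M K"
    using fg
    by (simp add: AdjMonoids_def adj_monoid_homs_def compose_eq closed_simps
        compose_monoid_homs[OF monoid_carrier homs] monoid_homs_closed[OF homs(1)])
qed (auto simp: AdjMonoids_def adj_monoid_homs_def compose_restrict_id restrict_id_compose
    compose_compose)

section \<open>The monad of an adjunction\<close>

definition induced_monad :: "'a adjunction \<Rightarrow> 'a adj_monoid" where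
  "induced_monad A =
     \<lparr>carrier = carrier (adj_dom A), mult = mult (adj_dom A), one = one (adj_dom A),
      endo = (\<lambda>m. adj_right A (adj_left A m)),
      eta = adj_unit A,
      eps = adj_right A (adj_counit A)\<rparr>"

lemma induced_monad_simps [simp]:
  "carrier (induced_monad A) = carrier (adj_dom A)"
  "mult (induced_monad A) = mult (adj_dom A)"
  "one (induced_monad A) = one (adj_dom A)"
  "endo (induced_monad A) m = adj_right A (adj_left A m)"
  "eta (induced_monad A) = adj_unit A"
  "eps (induced_monad A) = adj_right A (adj_counit A)"
  by (simp_all add: induced_monad_def)

text \<open>
  The monoids inside an adjunction and an algebra over them are records of different types, so
  they can share their structure without being equal.
\<close>

lemma monoid_same_structure:
  assumes "monoid M" "carrier K = carrier M" "mult K = mult M" "one K = one M"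
  shows "monoid K"
  using assms(1) unfolding monoid_def assms(2-4) .

lemma monoid_homs_same_structure:
  assumes "carrier K = carrier M" "mult K = mult M" "one K = one M"
    and "carrier L = carrier N" "mult L = mult N" "one L = one N"
  shows "monoid_homs K L = monoid_homs M N"
  unfolding monoid_homs_def hom_def assms ..

context monoid_adjunction
begin

text \<open>
  One triangle identity is a unit law as it stands. The image under \<open>g\<close> of the other is the other unit
  law, and the image under \<open>g\<close> of naturality of the counit gives naturality of the multiplication at
  \<open>f(m)\<close> and associativity at \<open>\<epsilon>\<close>.
\<close>

lemma is_adj_monoid_induced_monad: "is_adj_monoid (induced_monad A)"
  unfolding is_adj_monoid_def Let_def induced_monad_simps
proof (intro conjI ballI)
  have "(\<lambda>m. adj_right A (adj_left A m)) \<in> monoid_homs (adj_dom A) (adj_dom A)"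
    by (rule monoid_homsI)
      (simp_all add: left_mult right_mult left_one right_one closed_simps)
  then show "(\<lambda>m. adj_right A (adj_left A m)) \<in> monoid_homs (induced_monad A) (induced_monad A)"
    by (subst monoid_homs_same_structure[of _ "adj_dom A" _ "adj_dom A"]) simp_all
  show "monoid (induced_monad A)"
    by (rule monoid_same_structure[OF monoid_dom]) simp_all
qed (simp_all add: right_mult[symmetric] counit_natural unit_natural triangle_left triangle_right
    right_one closed_simps)

end

definition monad_functor ::
  "('a adjunction, ('a \<Rightarrow> 'a) \<times> ('a \<Rightarrow> 'a), 'a adj_monoid, 'a \<Rightarrow> 'a) func" where
  "monad_functor = \<lparr>on_ob = induced_monad, on_arr = (\<lambda>A B (l, r). l)\<rparr>"

lemma is_functor_monad_functor: "is_functor AdMon AdjMonoids monad_functor"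
proof -
  have "l \<in> adj_monoid_homs (induced_monad A) (induced_monad B)"
    if "is_adjunction A" and "(l, r) \<in> adjunction_homs A B" for A B :: "'a adjunction" and l r
  proof -
    interpret monoid_adjunction A by unfold_locales fact
    have "monoid_homs (induced_monad A) (induced_monad B) = monoid_homs (adj_dom A) (adj_dom B)"
      by (rule monoid_homs_same_structure) simp_all
    with that(2) show ?thesis
      by (auto simp: adjunction_homs_def adj_monoid_homs_def closed_simps)
  qed
  then show ?thesis
    by (auto simp: is_functor_def AdMon_def AdjMonoids_def monad_functor_def
        monoid_adjunction.is_adj_monoid_induced_monad monoid_adjunction_def)
qed

section \<open>The Kleisli adjunction of a monad\<close>

text \<open>
  The Kleisli arrow \<open>m\<close> is represented by its image under the right adjoint, an injective map
  that turns Kleisli composition into the multiplication of \<open>M\<close>.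
\<close>

definition kleisli_arrows :: "'a adj_monoid \<Rightarrow> 'a set" where
  "kleisli_arrows M = (\<lambda>m. eps M \<otimes>\<^bsub>M\<^esub> endo M m) ` carrier M"

definition kleisli_adjunction :: "'a adj_monoid \<Rightarrow> 'a adjunction" where
  "kleisli_adjunction M =
     \<lparr>adj_dom = \<lparr>carrier = carrier M, mult = mult M, one = one M\<rparr>,
      adj_cod = \<lparr>carrier = kleisli_arrows M, mult = mult M, one = one M\<rparr>,
      adj_left = endo M, adj_right = (\<lambda>x. x), adj_unit = eta M, adj_counit = eps M\<rparr>"

lemma kleisli_adjunction_simps [simp]:
  "carrier (adj_dom (kleisli_adjunction M)) = carrier M"
  "mult (adj_dom (kleisli_adjunction M)) = mult M"
  "one (adj_dom (kleisli_adjunction M)) = one M"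
  "carrier (adj_cod (kleisli_adjunction M)) = kleisli_arrows M"
  "mult (adj_cod (kleisli_adjunction M)) = mult M"
  "one (adj_cod (kleisli_adjunction M)) = one M"
  "adj_left (kleisli_adjunction M) = endo M"
  "adj_right (kleisli_adjunction M) x = x"
  "adj_unit (kleisli_adjunction M) = eta M"
  "adj_counit (kleisli_adjunction M) = eps M"
  by (simp_all add: kleisli_adjunction_def)

context monoid_monad
begin

lemma kleisli_arrows_closed: "x \<in> kleisli_arrows M \<Longrightarrow> x \<in> carrier M"
  by (auto simp: kleisli_arrows_def closed_simps)

lemma kleisli_arrowsI: "m \<in> carrier M \<Longrightarrow> x = eps M \<otimes> endo M m \<Longrightarrow> x \<in> kleisli_arrows M"
  by (auto simp: kleisli_arrows_def)

lemma one_in_kleisli_arrows: "\<one> \<in> kleisli_arrows M"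
  by (rule kleisli_arrowsI[of "eta M"]) (simp_all add: eps_endo_eta closed_simps)

lemma eps_in_kleisli_arrows: "eps M \<in> kleisli_arrows M"
  by (rule kleisli_arrowsI[of \<one>]) (simp_all add: endo_one closed_simps)

text \<open>
  The left adjoint of a Kleisli adjunction sends \<open>m\<close> to the Kleisli arrow \<open>\<eta> m\<close>, so \<open>f(m)\<close> has to be
  \<open>\<epsilon> f(\<eta> m)\<close>. The proof meets \<open>\<eta> m\<close> in the form \<open>f(m) \<eta>\<close>.
\<close>

lemma endo_in_kleisli_arrows:
  assumes "m \<in> carrier M"
  shows "endo M m \<in> kleisli_arrows M"
proof (rule kleisli_arrowsI)
  show "endo M m \<otimes> eta M \<in> carrier M"
    using assms by (simp add: closed_simps)
  have "endo M m = endo M m \<otimes> (eps M \<otimes> endo M (eta M))"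
    using assms by (simp add: eps_endo_eta closed_simps)
  also have "\<dots> = eps M \<otimes> endo M (endo M m) \<otimes> endo M (eta M)"
    using assms by (simp add: eps_natural m_assoc closed_simps)
  also have "\<dots> = eps M \<otimes> endo M (endo M m \<otimes> eta M)"
    using assms by (simp add: endo_mult m_assoc closed_simps)
  finally show "endo M m = \<dots>" .
qed

text \<open>
  The Kleisli product \<open>\<epsilon> f(m) k\<close> is mapped to a product. This is the step that uses
  associativity \<open>\<epsilon> f(\<epsilon>) = \<epsilon>\<^sup>2\<close> and makes the Kleisli arrows a submonoid.
\<close>

lemma kleisli_composition:
  assumes "m \<in> carrier M" "k \<in> carrier M"
  shows "(eps M \<otimes> endo M m) \<otimes> (eps M \<otimes> endo M k) = eps M \<otimes> endo M (eps M \<otimes> endo M m \<otimes> k)"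
proof -
  have "(eps M \<otimes> endo M m) \<otimes> (eps M \<otimes> endo M k) = eps M \<otimes> (endo M m \<otimes> eps M) \<otimes> endo M k"
    using assms by (simp add: m_assoc closed_simps)
  also have "\<dots> = eps M \<otimes> eps M \<otimes> endo M (endo M m) \<otimes> endo M k"
    using assms by (simp add: eps_natural[symmetric] m_assoc closed_simps)
  also have "\<dots> = eps M \<otimes> endo M (eps M) \<otimes> endo M (endo M m) \<otimes> endo M k"
    by (simp add: eps_assoc)
  also have "\<dots> = eps M \<otimes> endo M (eps M \<otimes> endo M m \<otimes> k)"
    using assms by (simp add: endo_mult m_assoc closed_simps)
  finally show ?thesis .
qed

lemma mult_in_kleisli_arrows:
  "x \<in> kleisli_arrows M \<Longrightarrow> y \<in> kleisli_arrows M \<Longrightarrow> x \<otimes> y \<in> kleisli_arrows M"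
  by (auto simp: kleisli_arrows_def[of M] kleisli_composition closed_simps)

text \<open>
  On all of \<open>M\<close> this law may fail; it holds on \<open>\<epsilon> f(m)\<close> because there associativity
  turns the inner \<open>f(\<epsilon>)\<close> into \<open>\<epsilon>\<close>, which leaves \<open>f\<^sup>2(m)\<close>, for which \<open>\<epsilon>\<close> is natural.
\<close>

lemma kleisli_counit_natural:
  assumes "x \<in> kleisli_arrows M"
  shows "eps M \<otimes> endo M x = x \<otimes> eps M"
proof -
  obtain m where m: "m \<in> carrier M" and x: "x = eps M \<otimes> endo M m"
    using assms by (auto simp: kleisli_arrows_def)
  have "eps M \<otimes> endo M x = eps M \<otimes> endo M (eps M) \<otimes> endo M (endo M m)"
    using m by (simp add: x endo_mult m_assoc closed_simps)
  also have "\<dots> = eps M \<otimes> (eps M \<otimes> endo M (endo M m))"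
    using m by (simp add: eps_assoc m_assoc closed_simps)
  also have "\<dots> = x \<otimes> eps M"
    using m by (simp add: x eps_natural m_assoc closed_simps)
  finally show ?thesis .
qed

lemma is_adjunction_kleisli_adjunction: "is_adjunction (kleisli_adjunction M)"
  unfolding is_adjunction_def Let_def kleisli_adjunction_simps
proof (intro conjI ballI)
  show "monoid (adj_dom (kleisli_adjunction M))"
    by (rule monoid_same_structure[OF monoid_carrier]) simp_all
  show "monoid (adj_cod (kleisli_adjunction M))"
    by (rule monoidI)
      (simp_all add: one_in_kleisli_arrows mult_in_kleisli_arrows kleisli_arrows_closed m_assoc)
  show "endo M \<in> monoid_homs (adj_dom (kleisli_adjunction M)) (adj_cod (kleisli_adjunction M))"
    by (rule monoid_homsI) (simp_all add: endo_in_kleisli_arrows endo_mult endo_one)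
  show "(\<lambda>x. x) \<in> monoid_homs (adj_cod (kleisli_adjunction M)) (adj_dom (kleisli_adjunction M))"
    by (rule monoid_homsI) (simp_all add: kleisli_arrows_closed)
qed (simp_all add: closed_simps eps_in_kleisli_arrows eta_natural kleisli_counit_natural
    eps_eta eps_endo_eta)

end

definition kleisli_functor ::
  "('a adj_monoid, 'a \<Rightarrow> 'a, 'a adjunction, ('a \<Rightarrow> 'a) \<times> ('a \<Rightarrow> 'a)) func" where
  "kleisli_functor =
     \<lparr>on_ob = kleisli_adjunction,
      on_arr = (\<lambda>M K h. (h, restrict h (kleisli_arrows M)))\<rparr>"

lemma adj_monoid_hom_kleisli_arrows:
  assumes "is_adj_monoid M" "h \<in> adj_monoid_homs M K" "x \<in> kleisli_arrows M"
  shows "h x \<in> kleisli_arrows K"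
proof -
  interpret monoid_monad M by unfold_locales fact
  obtain m where m: "m \<in> carrier M" and x: "x = eps M \<otimes>\<^bsub>M\<^esub> endo M m"
    using assms(3) by (auto simp: kleisli_arrows_def)
  have "h x = eps K \<otimes>\<^bsub>K\<^esub> endo K (h m)" "h m \<in> carrier K"
    using assms(2) m
    by (simp_all add: x adj_monoid_homs_def closed_simps monoid_homs_mult[of h M K]
        monoid_homs_closed[of h M K])
  then show ?thesis
    by (auto simp: kleisli_arrows_def)
qed

lemma is_functor_kleisli_functor: "is_functor AdjMonoids AdMon kleisli_functor"
proof -
  have arr: "(h, restrict h (kleisli_arrows M))
      \<in> adjunction_homs (kleisli_adjunction M) (kleisli_adjunction K)"
    if M: "is_adj_monoid M" and h: "h \<in> adj_monoid_homs M K" for M K :: "'a adj_monoid" and h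
  proof -
    interpret monoid_monad M by unfold_locales (rule M)
    have hom: "h \<in> monoid_homs M K"
      using h by (simp add: adj_monoid_homs_def)
    have "h \<in> monoid_homs (adj_dom (kleisli_adjunction M)) (adj_dom (kleisli_adjunction K))"
      using hom by (subst monoid_homs_same_structure[of _ M _ K]) simp_all
    moreover have "restrict h (kleisli_arrows M)
        \<in> monoid_homs (adj_cod (kleisli_adjunction M)) (adj_cod (kleisli_adjunction K))"
      by (rule monoid_homsI)
        (simp_all add: one_in_kleisli_arrows mult_in_kleisli_arrows kleisli_arrows_closed
          adj_monoid_hom_kleisli_arrows[OF M h] monoid_homs_mult[OF hom] monoid_homs_one[OF hom])
    ultimately show ?thesis
      using h
      by (simp add: adjunction_homs_def adj_monoid_homs_def endo_in_kleisli_arrows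
          eps_in_kleisli_arrows)
  qed
  moreover have "restrict (\<lambda>m \<in> carrier M. m) (kleisli_arrows M) = (\<lambda>m \<in> kleisli_arrows M. m)"
    if "is_adj_monoid M" for M :: "'a adj_monoid"
    using monoid_monad.kleisli_arrows_closed[OF monoid_monad.intro[OF that]]
    by (auto simp: restrict_def)
  moreover have "restrict (compose (carrier M) g h) (kleisli_arrows M) =
      compose (kleisli_arrows M) (restrict g (kleisli_arrows K)) (restrict h (kleisli_arrows M))"
    if "is_adj_monoid M" "h \<in> adj_monoid_homs M K" for M K :: "'a adj_monoid" and h g :: "'a \<Rightarrow> 'a"
    using monoid_monad.kleisli_arrows_closed[OF monoid_monad.intro[OF that(1)]]
      adj_monoid_hom_kleisli_arrows[OF that]
    by (auto simp: restrict_def compose_def)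
  ultimately show ?thesis
    by (simp add: is_functor_def AdMon_def AdjMonoids_def kleisli_functor_def
        monoid_monad.is_adjunction_kleisli_adjunction monoid_monad_def)
qed

section \<open>The equivalence\<close>

lemma induced_monad_kleisli_adjunction: "induced_monad (kleisli_adjunction M) = M"
  by (cases M) (simp add: induced_monad_def)

lemma naturally_isomorphic_monad_kleisli:
  "naturally_isomorphic AdjMonoids AdjMonoids (comp_func monad_functor kleisli_functor) id_func"
proof -
  have C: "is_category (AdjMonoids :: ('a adj_monoid, 'a \<Rightarrow> 'a) category)"
    by (rule is_category_AdjMonoids)
  show ?thesis
    unfolding naturally_isomorphic_def
    by (rule exI[of _ "id_arr AdjMonoids"])
      (use C in \<open>auto simp: is_category_def is_iso_def comp_func_def id_func_def
        monad_functor_def kleisli_functor_def induced_monad_kleisli_adjunction\<close>)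
qed

text \<open>
  On codomains the comparison has to invert \<open>g\<close> on its image. The formula is the transposition
  \<open>m \<mapsto> \<epsilon> f(m)\<close> of the adjunction, preceded by \<open>x \<mapsto> x \<eta>\<close>, which recovers the Kleisli arrow that \<open>x\<close>
  represents.
\<close>

definition comparison :: "'a adjunction \<Rightarrow> ('a \<Rightarrow> 'a) \<times> ('a \<Rightarrow> 'a)" where
  "comparison A =
     (\<lambda>m \<in> carrier (adj_dom A). m,
      \<lambda>x \<in> kleisli_arrows (induced_monad A).
        adj_counit A \<otimes>\<^bsub>adj_cod A\<^esub> adj_left A (x \<otimes>\<^bsub>adj_dom A\<^esub> adj_unit A))"

definition comparison_inverse :: "'a adjunction \<Rightarrow> ('a \<Rightarrow> 'a) \<times> ('a \<Rightarrow> 'a)" where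
  "comparison_inverse A =
     (\<lambda>m \<in> carrier (adj_dom A). m, restrict (adj_right A) (carrier (adj_cod A)))"

context monoid_adjunction
begin

text \<open>
  Transposing twice is the identity: \<open>n \<mapsto> g(n) \<eta>\<close> is the bijection of the adjunction from the
  codomain to the domain, and \<open>m \<mapsto> \<epsilon> f(m)\<close> is its inverse.
\<close>

lemma counit_left_right_unit:
  assumes "n \<in> carrier (adj_cod A)"
  shows "adj_counit A \<otimes>\<^bsub>adj_cod A\<^esub> adj_left A (adj_right A n \<otimes>\<^bsub>adj_dom A\<^esub> adj_unit A) = n"
proof -
  have "adj_counit A \<otimes>\<^bsub>adj_cod A\<^esub> adj_left A (adj_right A n \<otimes>\<^bsub>adj_dom A\<^esub> adj_unit A) =
      adj_counit A \<otimes>\<^bsub>adj_cod A\<^esub> adj_left A (adj_right A n) \<otimes>\<^bsub>adj_cod A\<^esub> adj_left A (adj_unit A)"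
    using assms by (simp add: left_mult N.m_assoc closed_simps)
  also have "\<dots> = n \<otimes>\<^bsub>adj_cod A\<^esub> (adj_counit A \<otimes>\<^bsub>adj_cod A\<^esub> adj_left A (adj_unit A))"
    using assms by (simp add: counit_natural N.m_assoc closed_simps)
  also have "\<dots> = n"
    using assms by (simp add: triangle_left)
  finally show ?thesis .
qed

lemma inj_on_right: "inj_on (adj_right A) (carrier (adj_cod A))"
  by (rule inj_on_inverseI) (rule counit_left_right_unit)

text \<open>
  A Kleisli arrow \<open>g(\<epsilon>) g(f(m))\<close> is \<open>g(\<epsilon> f(m))\<close>, and every element of the codomain has the form
  \<open>\<epsilon> f(m)\<close> by \<open>counit_left_right_unit\<close>.
\<close>

lemma kleisli_arrows_induced_monad:
  "kleisli_arrows (induced_monad A) = adj_right A ` carrier (adj_cod A)"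
proof
  show "kleisli_arrows (induced_monad A) \<subseteq> adj_right A ` carrier (adj_cod A)"
    by (auto simp: kleisli_arrows_def right_mult[symmetric] closed_simps)
  show "adj_right A ` carrier (adj_cod A) \<subseteq> kleisli_arrows (induced_monad A)"
  proof
    fix x assume "x \<in> adj_right A ` carrier (adj_cod A)"
    then obtain n where n: "n \<in> carrier (adj_cod A)" and x: "x = adj_right A n"
      by blast
    have "x = adj_right A (adj_counit A \<otimes>\<^bsub>adj_cod A\<^esub>
        adj_left A (adj_right A n \<otimes>\<^bsub>adj_dom A\<^esub> adj_unit A))"
      using n by (simp add: x counit_left_right_unit)
    also have "\<dots> = adj_right A (adj_counit A) \<otimes>\<^bsub>adj_dom A\<^esub>
        adj_right A (adj_left A (adj_right A n \<otimes>\<^bsub>adj_dom A\<^esub> adj_unit A))"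
      using n by (simp add: right_mult closed_simps)
    finally show "x \<in> kleisli_arrows (induced_monad A)"
      using n by (auto simp: kleisli_arrows_def closed_simps)
  qed
qed

lemma comparison_hom:
  "comparison A \<in> adjunction_homs (kleisli_adjunction (induced_monad A)) A"
proof -
  let ?K = "kleisli_adjunction (induced_monad A)"
  let ?r = "snd (comparison A)"
  have r: "?r (adj_right A n) = n" if "n \<in> carrier (adj_cod A)" for n
    using that
    by (simp add: comparison_def kleisli_arrows_induced_monad counit_left_right_unit)
  have "?r \<in> monoid_homs (adj_cod ?K) (adj_cod A)"
  proof (rule monoid_homsI)
    show "?r x \<in> carrier (adj_cod A)" if "x \<in> carrier (adj_cod ?K)" for x
      using that r by (auto simp: kleisli_arrows_induced_monad)
    show "?r (x \<otimes>\<^bsub>adj_cod ?K\<^esub> y) = ?r x \<otimes>\<^bsub>adj_cod A\<^esub> ?r y"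
      if "x \<in> carrier (adj_cod ?K)" "y \<in> carrier (adj_cod ?K)" for x y
      using that by (auto simp: kleisli_arrows_induced_monad r right_mult[symmetric])
    show "?r \<one>\<^bsub>adj_cod ?K\<^esub> = \<one>\<^bsub>adj_cod A\<^esub>"
      using r[OF N.one_closed] by (simp add: right_one)
  qed
  moreover have "(\<lambda>m \<in> carrier (adj_dom A). m) \<in> monoid_homs (adj_dom ?K) (adj_dom A)"
    by (rule monoid_homsI) simp_all
  moreover have "?r (adj_right A (adj_left A m)) = adj_left A m" if "m \<in> carrier (adj_dom A)" for m
    using that by (simp add: r closed_simps)
  moreover have "x = adj_right A (?r x) \<and> x \<in> carrier (adj_dom A)"
    if "x \<in> kleisli_arrows (induced_monad A)" for x
    using that by (auto simp: kleisli_arrows_induced_monad r closed_simps)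
  moreover have "?r (adj_right A (adj_counit A)) = adj_counit A"
    by (simp add: r closed_simps)
  moreover have "?r \<in> extensional (kleisli_arrows (induced_monad A))"
    by (simp add: comparison_def)
  moreover have "comparison A = (\<lambda>m \<in> carrier (adj_dom A). m, ?r)"
    by (simp add: comparison_def)
  ultimately show ?thesis
    by (auto simp: adjunction_homs_def closed_simps)
qed

lemma comparison_inverse_hom:
  "comparison_inverse A \<in> adjunction_homs A (kleisli_adjunction (induced_monad A))"
proof -
  let ?K = "kleisli_adjunction (induced_monad A)"
  have "restrict (adj_right A) (carrier (adj_cod A)) \<in> monoid_homs (adj_cod A) (adj_cod ?K)"
    by (rule monoid_homsI) (simp_all add: kleisli_arrows_induced_monad right_mult right_one)
  moreover have "(\<lambda>m \<in> carrier (adj_dom A). m) \<in> monoid_homs (adj_dom A) (adj_dom ?K)"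
    by (rule monoid_homsI) simp_all
  ultimately show ?thesis
    by (simp add: adjunction_homs_def comparison_inverse_def closed_simps)
qed

lemma is_iso_comparison:
  "is_iso AdMon (kleisli_adjunction (induced_monad A)) A (comparison A)"
  unfolding is_iso_def
proof (intro conjI bexI)
  let ?K = "kleisli_adjunction (induced_monad A)"
  show "comparison A \<in> hom_set AdMon ?K A"
    by (simp add: AdMon_def comparison_hom)
  show "comparison_inverse A \<in> hom_set AdMon A ?K"
    by (simp add: AdMon_def comparison_inverse_hom)
  show "comp_arr AdMon ?K A ?K (comparison_inverse A) (comparison A) = id_arr AdMon ?K"
    by (auto simp: AdMon_def comparison_def comparison_inverse_def compose_def restrict_def fun_eq_iff
        kleisli_arrows_induced_monad counit_left_right_unit closed_simps)
  show "comp_arr AdMon A ?K A (comparison A) (comparison_inverse A) = id_arr AdMon A"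
    by (auto simp: AdMon_def comparison_def comparison_inverse_def compose_def restrict_def fun_eq_iff
        kleisli_arrows_induced_monad counit_left_right_unit closed_simps)
qed

end

text \<open>
  A morphism \<open>(l, r)\<close> satisfies \<open>l \<circ> g = g' \<circ> r\<close>; after identifying the codomains with the images of
  the right adjoints, \<open>r\<close> is therefore the restriction of \<open>l\<close>.
\<close>

lemma comparison_natural:
  assumes "is_adjunction A" "is_adjunction B" "(l, r) \<in> adjunction_homs A B"
  shows "comp_arr AdMon (kleisli_adjunction (induced_monad A)) (kleisli_adjunction (induced_monad B)) B
      (comparison B) (l, restrict l (kleisli_arrows (induced_monad A))) =
    comp_arr AdMon (kleisli_adjunction (induced_monad A)) A B (l, r) (comparison A)"
proof -
  interpret A: monoid_adjunction A by unfold_locales fact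
  interpret B: monoid_adjunction B by unfold_locales fact
  have l: "l \<in> monoid_homs (adj_dom A) (adj_dom B)"
    and r: "r \<in> monoid_homs (adj_cod A) (adj_cod B)"
    and lg: "\<And>n. n \<in> carrier (adj_cod A) \<Longrightarrow> l (adj_right A n) = adj_right B (r n)"
    using assms(3) by (auto simp: adjunction_homs_def)
  show ?thesis
    by (auto simp: AdMon_def comparison_def compose_def restrict_def fun_eq_iff lg
        A.kleisli_arrows_induced_monad B.kleisli_arrows_induced_monad
        A.counit_left_right_unit B.counit_left_right_unit A.closed_simps
        inj_on_eq_iff[OF B.inj_on_right]
        monoid_homs_closed[OF l] monoid_homs_closed[OF r])
qed

lemma naturally_isomorphic_kleisli_monad:
  "naturally_isomorphic AdMon AdMon (comp_func kleisli_functor monad_functor) id_func"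
  unfolding naturally_isomorphic_def
proof (rule exI[of _ comparison], intro conjI ballI)
  fix A :: "'a adjunction"
  assume "A \<in> ob AdMon"
  then have "is_adjunction A"
    by (simp add: AdMon_def)
  then show "is_iso AdMon (on_ob (comp_func kleisli_functor monad_functor) A) (on_ob id_func A)
      (comparison A)"
    by (simp add: comp_func_def id_func_def kleisli_functor_def monad_functor_def
        monoid_adjunction.is_iso_comparison monoid_adjunction_def)
next
  fix A B :: "'a adjunction" and lr
  assume "A \<in> ob AdMon" "B \<in> ob AdMon" "lr \<in> hom_set AdMon A B"
  then have AB: "is_adjunction A" "is_adjunction B" and lr: "(fst lr, snd lr) \<in> adjunction_homs A B"
    by (simp_all add: AdMon_def)
  show "comp_arr AdMon (on_ob (comp_func kleisli_functor monad_functor) A)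
      (on_ob (comp_func kleisli_functor monad_functor) B) (on_ob id_func B) (comparison B)
      (on_arr (comp_func kleisli_functor monad_functor) A B lr) =
    comp_arr AdMon (on_ob (comp_func kleisli_functor monad_functor) A) (on_ob id_func A)
      (on_ob id_func B) (on_arr id_func A B lr) (comparison A)"
    using comparison_natural[OF AB lr]
    by (simp add: comp_func_def id_func_def kleisli_functor_def monad_functor_def split_beta)
qed

lemma equivalent_AdMon_AdjMonoids:
  "equivalent_categories
     (AdMon :: ('a adjunction, ('a \<Rightarrow> 'a) \<times> ('a \<Rightarrow> 'a)) category)
     (AdjMonoids :: ('a adj_monoid, 'a \<Rightarrow> 'a) category)"
  unfolding equivalent_categories_def
  using is_category_AdMon is_category_AdjMonoids is_functor_monad_functor
    is_functor_kleisli_functor naturally_isomorphic_kleisli_monad naturally_isomorphic_monad_kleisli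
  by blast

section \<open>The variety\<close>

lemma all_adj_op: "(\<forall>s. P s) \<longleftrightarrow> P Op_mult \<and> P Op_one \<and> P Op_endo \<and> P Op_eta \<and> P Op_eps"
  by (metis adj_op.exhaust)

lemma all_lists_length_1: "(\<forall>xs. length xs = 1 \<and> set xs \<subseteq> A \<longrightarrow> P xs) \<longleftrightarrow> (\<forall>x \<in> A. P [x])"
  by (auto simp: length_Suc_conv)

lemma all_lists_length_2:
  "(\<forall>xs. length xs = 2 \<and> set xs \<subseteq> A \<longrightarrow> P xs) \<longleftrightarrow> (\<forall>x \<in> A. \<forall>y \<in> A. P [x, y])"
  by (auto simp: length_Suc_conv numeral_2_eq_2)

lemma sig_algebra_adj_interp:
  "sig_algebra adj_arity (carrier M) (adj_interp M) \<longleftrightarrow>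
    (\<forall>x \<in> carrier M. \<forall>y \<in> carrier M. x \<otimes>\<^bsub>M\<^esub> y \<in> carrier M) \<and> \<one>\<^bsub>M\<^esub> \<in> carrier M \<and>
    (\<forall>x \<in> carrier M. endo M x \<in> carrier M) \<and> eta M \<in> carrier M \<and> eps M \<in> carrier M"
  unfolding sig_algebra_def all_adj_op adj_arity.simps all_lists_length_1 all_lists_length_2
  by (auto simp: adj_interp_def)

lemma is_adj_monoid_iff_identities:
  "is_adj_monoid M \<longleftrightarrow> sig_algebra adj_arity (carrier M) (adj_interp M) \<and>
    (\<forall>e \<in> adj_identities. satisfies (carrier M) (adj_interp M) e)"
  (is "_ \<longleftrightarrow> ?algebra \<and> ?identities")
proof
  assume "is_adj_monoid M"
  then interpret monoid_monad M by unfold_locales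
  have ?algebra
    by (simp add: sig_algebra_adj_interp closed_simps)
  moreover have ?identities
    by (simp add: adj_identities_def Let_def satisfies_def adj_interp_def m_assoc endo_mult endo_one
        eps_eta eps_endo_eta eps_assoc eps_natural eta_natural)
  ultimately show "?algebra \<and> ?identities" ..
next
  assume algebra_identities: "?algebra \<and> ?identities"
  then have closed: "\<And>x y. x \<in> carrier M \<Longrightarrow> y \<in> carrier M \<Longrightarrow> x \<otimes>\<^bsub>M\<^esub> y \<in> carrier M"
    "\<one>\<^bsub>M\<^esub> \<in> carrier M" "\<And>x. x \<in> carrier M \<Longrightarrow> endo M x \<in> carrier M"
    "eta M \<in> carrier M" "eps M \<in> carrier M"
    by (simp_all add: sig_algebra_adj_interp)
  have "x \<otimes>\<^bsub>M\<^esub> y \<otimes>\<^bsub>M\<^esub> z = x \<otimes>\<^bsub>M\<^esub> (y \<otimes>\<^bsub>M\<^esub> z) \<and> \<one>\<^bsub>M\<^esub> \<otimes>\<^bsub>M\<^esub> x = x \<and> x \<otimes>\<^bsub>M\<^esub> \<one>\<^bsub>M\<^esub> = x \<and>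
      endo M (x \<otimes>\<^bsub>M\<^esub> y) = endo M x \<otimes>\<^bsub>M\<^esub> endo M y \<and> endo M \<one>\<^bsub>M\<^esub> = \<one>\<^bsub>M\<^esub> \<and>
      eps M \<otimes>\<^bsub>M\<^esub> eta M = \<one>\<^bsub>M\<^esub> \<and> eps M \<otimes>\<^bsub>M\<^esub> endo M (eta M) = \<one>\<^bsub>M\<^esub> \<and>
      eps M \<otimes>\<^bsub>M\<^esub> endo M (eps M) = eps M \<otimes>\<^bsub>M\<^esub> eps M \<and>
      eps M \<otimes>\<^bsub>M\<^esub> endo M (endo M x) = endo M x \<otimes>\<^bsub>M\<^esub> eps M \<and>
      endo M x \<otimes>\<^bsub>M\<^esub> eta M = eta M \<otimes>\<^bsub>M\<^esub> x"
    if "x \<in> carrier M" "y \<in> carrier M" "z \<in> carrier M" for x y z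
  proof -
    \<comment> \<open>The identities use only the variables 0, 1 and 2.\<close>
    define v :: "nat \<Rightarrow> 'a" where "v i = (if i = 0 then x else if i = 1 then y else z)" for i
    have v: "\<forall>i. v i \<in> carrier M" and v_simps: "v 0 = x" "v (Suc 0) = y" "v 2 = z"
      using that by (simp_all add: v_def)
    have "\<forall>e \<in> adj_identities. trm_val (adj_interp M) v (fst e) = trm_val (adj_interp M) v (snd e)"
      using algebra_identities v unfolding satisfies_def by blast
    then show ?thesis
      by (simp add: adj_identities_def Let_def adj_interp_def v_simps)
  qed
  \<comment> \<open>Identities that do not contain all variables need some value for the others.\<close>
  note identities = this[OF _ closed(2) closed(2)] this[OF closed(2) closed(2) closed(2)] this
  have "monoid M"
    by (rule monoidI) (use closed identities in blast)+
  moreover have "endo M \<in> monoid_homs M M"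
    by (rule monoid_homsI) (use closed identities in blast)+
  ultimately show "is_adj_monoid M"
    using closed identities(1,2) by (simp add: is_adj_monoid_def)
qed

lemma adj_monoid_homs_eq_sig_homs:
  "adj_monoid_homs M K =
    sig_homs adj_arity (carrier M) (adj_interp M) (carrier K) (adj_interp K)"
  unfolding sig_homs_def all_adj_op adj_arity.simps all_lists_length_1 all_lists_length_2
  by (auto simp: adj_monoid_homs_def adj_interp_def monoid_homs_def hom_def PiE_def)

lemma is_variety_AdjMonoids:
  "is_variety adj_arity adj_identities carrier adj_interp AdjMonoids"
proof -
  have "\<forall>(s, t) \<in> adj_identities. wf_trm adj_arity s \<and> wf_trm adj_arity t"
    by (simp add: adj_identities_def Let_def)
  then show ?thesis
    by (simp add: is_variety_def AdjMonoids_def adj_monoid_homs_eq_sig_homs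
        is_adj_monoid_iff_identities[symmetric])
qed

theorem proposition4:
  shows "equivalent_categories
           (AdMon :: ('a adjunction, ('a \<Rightarrow> 'a) \<times> ('a \<Rightarrow> 'a)) category)
           (AdjMonoids :: ('a adj_monoid, 'a \<Rightarrow> 'a) category) \<and>
         is_variety adj_arity adj_identities carrier adj_interp
           (AdjMonoids :: ('a adj_monoid, 'a \<Rightarrow> 'a) category)"
  using equivalent_AdMon_AdjMonoids is_variety_AdjMonoids by blast

end
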